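(* Let $(\mathfrak g,\mathfrak v,\pi)$ be a Lorentzian or degenerate Lorentzian data set. Then $\mathfrak g$ is not semisimple; that is, its center $\mathfrak c$ is non-trivial.
   Context: A metric on a real vector space is a non-degenerate symmetric bilinear form; Lorentzian means exactly one negative direction; $\mathfrak{so}$ denotes skew-symmetric endomorphisms. A data set is a triple $(\mathfrak g,\mathfrak v,\pi)$ where $\mathfrak g$ is a (finite-dimensional real) Lie algebra with an $\mathrm{ad}$-invariant metric $\langle\cdot,\cdot\rangle_{\mathfrak g}$ (each $\mathrm{ad}_Z$ is skew-symmetric), $\mathfrak v$ is a real vector space with a metric $\langle\cdot,\cdot\rangle_{\mathfrak v}$, and $\pi:\mathfrak g\to\mathfrak{so}(\mathfrak v,\langle\cdot,\cdot\rangle_{\mathfrak v})$ is a faithful representation. Assume that the orthogonal direct sum metric $\langle\cdot,\cdot\rangle$ on $\mathfrak g\oplus\mathfrak v$ is Lorentzian. The data set is called a Lorentzian data set if $\bigcap_{Z\in\mathfrak g}\ker\pi(Z)=\{0\}$, and a degenerate Lorentzian data set if $\bigcap_{Z\in\mathfrak g}\ker\pi(Z)=\mathbb R E$ for some $0\neq E\in\mathfrak v$ with $\langle E,E\rangle=0$.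
   Formalization: The real vector space v is assumed finite-dimensional, which the text does not say; without it the claim fails, e.g. for sl(2,R) with its Killing form acting by invariant vector fields on compactly supported smooth functions on SL(2,R) with the L2 product. *)

theory Defs
  imports "HOL-Analysis.Analysis"
begin

section \<open>Metrics\<close>

definition finite_dimensional_space :: "'a::real_vector itself \<Rightarrow> bool" where
  "finite_dimensional_space _ \<longleftrightarrow> (\<exists>B::'a set. finite B \<and> span B = UNIV)"

definition vs_metric :: "('a::real_vector \<Rightarrow> 'a \<Rightarrow> real) \<Rightarrow> bool" where
  "vs_metric b \<longleftrightarrow> bilinear b \<and> (\<forall>x y. b x y = b y x) \<and> (\<forall>x. (\<forall>y. b x y = 0) \<longrightarrow> x = 0)"

text \<open>
  The index of a form is the largest dimension of a subspace on which it is negative definite.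
  The maximum is over a finite set as soon as the space is finite-dimensional, the only case
  in which it is used.
\<close>

definition form_index :: "('a::real_vector \<Rightarrow> 'a \<Rightarrow> real) \<Rightarrow> nat" where
  "form_index b = Max {dim S | S. subspace S \<and> (\<forall>x\<in>S. x \<noteq> 0 \<longrightarrow> b x x < 0)}"

definition lorentzian_metric :: "('a::real_vector \<Rightarrow> 'a \<Rightarrow> real) \<Rightarrow> bool" where
  "lorentzian_metric b \<longleftrightarrow> vs_metric b \<and> form_index b = 1"

definition direct_sum_metric ::
    "('a \<Rightarrow> 'a \<Rightarrow> real) \<Rightarrow> ('b \<Rightarrow> 'b \<Rightarrow> real) \<Rightarrow> ('a \<times> 'b \<Rightarrow> 'a \<times> 'b \<Rightarrow> real)" where
  "direct_sum_metric b c = (\<lambda>p q. b (fst p) (fst q) + c (snd p) (snd q))"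

definition so_endos :: "('a::real_vector \<Rightarrow> 'a \<Rightarrow> real) \<Rightarrow> ('a \<Rightarrow> 'a) set" where
  "so_endos b = {A. linear A \<and> (\<forall>x y. b (A x) y = - b x (A y))}"


section \<open>Lie algebras\<close>

definition lie_bracket :: "('g::real_vector \<Rightarrow> 'g \<Rightarrow> 'g) \<Rightarrow> bool" where
  "lie_bracket br \<longleftrightarrow> bilinear br \<and> (\<forall>x. br x x = 0) \<and>
     (\<forall>x y z. br x (br y z) + br y (br z x) + br z (br x y) = 0)"

definition lie_center :: "('g::real_vector \<Rightarrow> 'g \<Rightarrow> 'g) \<Rightarrow> 'g set" where
  "lie_center br = {z. \<forall>x. br z x = 0}"

definition lie_ideal :: "('g::real_vector \<Rightarrow> 'g \<Rightarrow> 'g) \<Rightarrow> 'g set \<Rightarrow> bool" where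
  "lie_ideal br I \<longleftrightarrow> subspace I \<and> (\<forall>x. \<forall>y\<in>I. br x y \<in> I)"

primrec derived_series :: "('g::real_vector \<Rightarrow> 'g \<Rightarrow> 'g) \<Rightarrow> 'g set \<Rightarrow> nat \<Rightarrow> 'g set" where
  "derived_series br I 0 = I"
| "derived_series br I (Suc n) =
     span {br x y | x y. x \<in> derived_series br I n \<and> y \<in> derived_series br I n}"

text \<open>Semisimple means that the radical, the largest solvable ideal, is zero.\<close>

definition lie_semisimple :: "('g::real_vector \<Rightarrow> 'g \<Rightarrow> 'g) \<Rightarrow> bool" where
  "lie_semisimple br \<longleftrightarrow>
     (\<forall>I. lie_ideal br I \<and> (\<exists>n. derived_series br I n = {0}) \<longrightarrow> I = {0})"


section \<open>Data sets\<close>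

text \<open>
  Linearity of the representation in the Lie algebra argument is stated pointwise, because
  the function type \<open>'v \<Rightarrow> 'v\<close> is not an instance of \<^class>\<open>real_vector\<close>.
\<close>

definition faithful_so_representation ::
    "('g::real_vector \<Rightarrow> 'g \<Rightarrow> 'g) \<Rightarrow> ('v::real_vector \<Rightarrow> 'v \<Rightarrow> real) \<Rightarrow> ('g \<Rightarrow> 'v \<Rightarrow> 'v) \<Rightarrow> bool" where
  "faithful_so_representation br bv \<pi> \<longleftrightarrow>
     (\<forall>Z. \<pi> Z \<in> so_endos bv) \<and>
     (\<forall>x. linear (\<lambda>Z. \<pi> Z x)) \<and>
     (\<forall>Z W x. \<pi> (br Z W) x = \<pi> Z (\<pi> W x) - \<pi> W (\<pi> Z x)) \<and>
     inj \<pi>"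

text \<open>
  \<open>bg\<close> and \<open>bv\<close> are the metrics of the Lie algebra \<open>('g, br)\<close> and of the representation
  space \<open>'v\<close>. Finite dimension of \<open>'v\<close> is part of the definition: finiteness of the dimension
  of \<open>'g\<close> alone is not enough, since infinitesimally unitary infinite-dimensional representations
  of sl(2,R) exist.
\<close>

definition data_set ::
    "('g::real_vector \<Rightarrow> 'g \<Rightarrow> 'g) \<Rightarrow> ('g \<Rightarrow> 'g \<Rightarrow> real) \<Rightarrow>
     ('v::real_vector \<Rightarrow> 'v \<Rightarrow> real) \<Rightarrow> ('g \<Rightarrow> 'v \<Rightarrow> 'v) \<Rightarrow> bool" where
  "data_set br bg bv \<pi> \<longleftrightarrow>
     finite_dimensional_space TYPE('g) \<and> finite_dimensional_space TYPE('v) \<and>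
     lie_bracket br \<and>
     vs_metric bg \<and> (\<forall>Z. br Z \<in> so_endos bg) \<and>
     vs_metric bv \<and>
     faithful_so_representation br bv \<pi>"

definition common_kernel :: "('g \<Rightarrow> 'v \<Rightarrow> 'v::zero) \<Rightarrow> 'v set" where
  "common_kernel \<pi> = (\<Inter>Z. {x. \<pi> Z x = 0})"

definition lorentzian_data_set ::
    "('g::real_vector \<Rightarrow> 'g \<Rightarrow> 'g) \<Rightarrow> ('g \<Rightarrow> 'g \<Rightarrow> real) \<Rightarrow>
     ('v::real_vector \<Rightarrow> 'v \<Rightarrow> real) \<Rightarrow> ('g \<Rightarrow> 'v \<Rightarrow> 'v) \<Rightarrow> bool" where
  "lorentzian_data_set br bg bv \<pi> \<longleftrightarrow>
     data_set br bg bv \<pi> \<and> lorentzian_metric (direct_sum_metric bg bv) \<and>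
     common_kernel \<pi> = {0}"

definition degenerate_lorentzian_data_set ::
    "('g::real_vector \<Rightarrow> 'g \<Rightarrow> 'g) \<Rightarrow> ('g \<Rightarrow> 'g \<Rightarrow> real) \<Rightarrow>
     ('v::real_vector \<Rightarrow> 'v \<Rightarrow> real) \<Rightarrow> ('g \<Rightarrow> 'v \<Rightarrow> 'v) \<Rightarrow> bool" where
  "degenerate_lorentzian_data_set br bg bv \<pi> \<longleftrightarrow>
     data_set br bg bv \<pi> \<and> lorentzian_metric (direct_sum_metric bg bv) \<and>
     (\<exists>E. E \<noteq> 0 \<and> bv E E = 0 \<and> common_kernel \<pi> = span {E})"

end

theory Submission imports Defs begin

text \<open>
  If \<open>bg\<close> has a negative vector, then \<open>bv\<close> is definite and \<open>K X Y = - tr (\<pi> X \<circ> \<pi> Y)\<close> is a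
  definite invariant form. A minimum \<open>T\<close> of \<open>bg / K\<close> spans an eigenspace, which is an ideal and
  negative definite for \<open>bg\<close>, hence a line; \<open>K\<close>-skewness of \<open>ad\<close> makes \<open>T\<close> central.

  Otherwise \<open>bg\<close> is definite and \<open>bv\<close> is Lorentzian. Suppose the center is trivial; then the Lie
  algebra is perfect, so it kills every line that it preserves. Let \<open>f x y = \<Sum>e. bv (\<pi> e x) (\<pi> e y)\<close>,
  with \<open>e\<close> in an orthonormal basis of \<open>bg\<close>, be the form of the negative Casimir operator.

  If the common kernel is zero, \<open>f\<close> is positive on the causal cone, and maximising \<open>- bv / f\<close> there
  gives a timelike \<open>x\<close> with \<open>f x = - \<lambda> bv x\<close>, and so also \<open>f y = - \<lambda> bv y\<close> for \<open>y = \<pi> X x\<close>. Splitting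
  \<open>\<pi> e y\<close> along \<open>x\<close> and its orthogonal complement, the Cauchy-Schwarz inequality
  \<open>(bv y (\<pi> e x))\<^sup>2 \<le> bv y y * bv (\<pi> e x) (\<pi> e x)\<close> forces the component orthogonal to \<open>x\<close> to vanish.
  Hence \<open>\<pi> Z (\<pi> X x)\<close> is a multiple of \<open>x\<close> that is symmetric in \<open>X\<close> and \<open>Z\<close>, brackets kill \<open>x\<close>, and
  by perfectness \<open>x\<close> is in the common kernel.

  If the common kernel is a null line spanned by \<open>E\<close>, then \<open>f\<close> is positive semidefinite with radical
  spanned by \<open>E\<close>, so \<open>bv E = f w\<close> for some \<open>w\<close>. Invariance puts \<open>\<pi> Z w\<close> into the radical; by
  perfectness \<open>w\<close> is fixed, so \<open>f w = 0\<close>, which contradicts the non-degeneracy of \<open>bv\<close>.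
\<close>

section \<open>Symmetric bilinear forms\<close>

locale symmetric_form =
  fixes b :: "'a::real_vector \<Rightarrow> 'a \<Rightarrow> real"
  assumes bilinear: "bilinear b" and sym: "b x y = b y x"
begin

lemmas add = bilinear_ladd[OF bilinear] bilinear_radd[OF bilinear]
lemmas diff = bilinear_lsub[OF bilinear] bilinear_rsub[OF bilinear]
lemmas scale = bilinear_lmul[OF bilinear] bilinear_rmul[OF bilinear]
lemmas zero [simp] = bilinear_lzero[OF bilinear] bilinear_rzero[OF bilinear]

lemma linear_right: "linear (b x)"
  using bilinear unfolding bilinear_def by (metis eta_contract_eq)

lemma linear_left: "linear (\<lambda>x. b x y)"
  using bilinear unfolding bilinear_def by blast

lemma sum_left: "b (sum h A) y = (\<Sum>i\<in>A. b (h i) y)"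
  using linear_sum[OF linear_left] .

lemma sum_right: "b y (sum h A) = (\<Sum>i\<in>A. b y (h i))"
  using linear_sum[OF linear_right] .

lemma expand: "b (x + t *\<^sub>R y) (x + t *\<^sub>R y) = b x x + 2 * t * b x y + t\<^sup>2 * b y y"
  by (simp add: add scale sym[of y x] power2_eq_square algebra_simps)

text \<open>Semidefiniteness enters only on the span of \<open>x\<close> and \<open>y\<close>, so
  the inequality is also available inside orthogonal complements for an indefinite
  \<open>b\<close>.\<close>

lemma Cauchy_Schwarz:
  assumes psd: "\<And>s t. b (s *\<^sub>R x + t *\<^sub>R y) (s *\<^sub>R x + t *\<^sub>R y) \<ge> 0"
  shows "(b x y)\<^sup>2 \<le> b x x * b y y"
proof -
  have q: "0 \<le> s\<^sup>2 * b x x + 2 * s * t * b x y + t\<^sup>2 * b y y" for s t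
    using psd[of s t] by (simp add: add scale sym[of y x] power2_eq_square algebra_simps)
  show ?thesis
  proof (cases "b y y = 0")
    case True
    have "b x y = 0"
    proof (rule ccontr)
      assume ne: "b x y \<noteq> 0"
      \<comment> \<open>This \<open>t\<close> gives the quadratic the value
        \<open>-1\<close>.\<close>
      show False using q[of 1 "- (b x x + 1) / (2 * b x y)"] True ne by (simp add: field_simps)
    qed
    then show ?thesis using True by simp
  next
    case False
    then have pos: "b y y > 0" using q[of 0 1] by simp
    have "0 \<le> b y y * (b x x * b y y - (b x y)\<^sup>2)"
      using q[of "b y y" "- b x y"] by (simp add: power2_eq_square algebra_simps)
    then show ?thesis using pos by (simp add: zero_le_mult_iff)
  qed
qed

lemma definite_if_semidefinite:
  assumes "\<And>x. b x x \<ge> 0" and nondeg: "\<And>x. (\<And>y. b x y = 0) \<Longrightarrow> x = 0" and "x \<noteq> 0"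
  shows "b x x > 0"
proof (rule ccontr)
  assume "\<not> b x x > 0"
  then have "b x x = 0" using assms(1)[of x] by simp
  then have "b x y = 0" for y using Cauchy_Schwarz[of x y] assms(1) by simp
  then show False using nondeg \<open>x \<noteq> 0\<close> by blast
qed

end

lemma symmetric_form_if_vs_metric: "vs_metric b \<Longrightarrow> symmetric_form b"
  unfolding vs_metric_def symmetric_form_def by blast

lemma vs_metric_nondegenerate: "vs_metric b \<Longrightarrow> (\<And>y. b x y = 0) \<Longrightarrow> x = 0"
  unfolding vs_metric_def by blast

lemma finite_basis:
  assumes "finite_dimensional_space TYPE('a::real_vector)"
  obtains B :: "'a::real_vector set" where "finite B" "independent B" "span B = UNIV"
proof -
  obtain A :: "'a set" where A: "finite A" "span A = UNIV"
    using assms unfolding finite_dimensional_space_def by blast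
  obtain B where B: "B \<subseteq> A" "independent B" "A \<subseteq> span B"
    using maximal_independent_subset by blast
  have "span B = UNIV" using A(2) B(3) by (metis span_mono span_span top.extremum_uniqueI)
  then show thesis using that A(1) B finite_subset by blast
qed

text \<open>
  The extremum of the ratio of \<^term>\<open>b\<close> to \<^term>\<open>f\<close> is taken over the non-positive cone of
  \<^term>\<open>b\<close>. Since the space has no topology, compactness is obtained in coordinates.
\<close>

lemma pencil_eigenvector:
  fixes b f :: "'a::real_vector \<Rightarrow> 'a \<Rightarrow> real"
  assumes fd: "finite_dimensional_space TYPE('a)"
    and "symmetric_form b" and "symmetric_form f"
    and u: "b u u < 0"
    and fpos: "\<And>x. x \<noteq> 0 \<Longrightarrow> b x x \<le> 0 \<Longrightarrow> f x x > 0"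
  obtains x M where "M > 0" "b x x < 0" "\<And>y. b x y = - M * f x y"
proof -
  interpret b: symmetric_form b by fact
  interpret f: symmetric_form f by fact
  obtain B :: "'a set" where B: "finite B" "independent B" "span B = UNIV"
    using finite_basis[OF fd] .
  define \<phi> where "\<phi> c = (\<Sum>v\<in>B. c v *\<^sub>R v)" for c
  define r where "r c = - b (\<phi> c) (\<phi> c) / f (\<phi> c) (\<phi> c)" for c
  \<comment> \<open>Coordinate vectors are functions on the whole space; pinning the coordinates off
    \<open>B\<close> to zero makes this a product of compact sets, so Tychonoff applies.\<close>
  define box where "box = (\<Pi>\<^sub>E v\<in>(UNIV::'a set). if v \<in> B then {-1..1::real} else {0})"
  define S where "S = box \<inter> {c. (\<Sum>v\<in>B. (c v)\<^sup>2) = 1} \<inter> {c. b (\<phi> c) (\<phi> c) \<le> 0}"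
  have coord: "continuous_on UNIV (\<lambda>c. c v)" for v :: 'a
    by (rule continuous_on_product_coordinates)
  have cont: "continuous_on UNIV (\<lambda>c. h (\<phi> c) (\<phi> c))" if "symmetric_form h" for h
  proof -
    interpret h: symmetric_form h by fact
    have "h (\<phi> c) (\<phi> c) = (\<Sum>v\<in>B. \<Sum>w\<in>B. c v * (c w * h w v))" for c
      unfolding \<phi>_def by (simp add: h.sum_left h.sum_right h.scale sum_distrib_left)
    then show ?thesis by (simp only:) (intro continuous_intros coord)
  qed
  have "compact box"
    unfolding box_def compactin_euclidean_iff[symmetric] euclidean_product_topology[symmetric]
      compactin_PiE by auto
  moreover have "closed {c::'a \<Rightarrow> real. (\<Sum>v\<in>B. (c v)\<^sup>2) = 1}"
    by (rule closed_Collect_eq) (intro continuous_intros coord)+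
  moreover have "closed {c. b (\<phi> c) (\<phi> c) \<le> 0}"
    by (rule closed_Collect_le) (intro continuous_intros cont assms)+
  ultimately have "compact S"
    unfolding S_def by (intro compact_Int_closed)
  have \<phi>_ne: "\<phi> c \<noteq> 0" if "c \<in> S" for c
  proof
    assume "\<phi> c = 0"
    then have "\<forall>v\<in>B. c v = 0"
      using B independentD[of B B c] unfolding \<phi>_def by blast
    then show False using that unfolding S_def by simp
  qed
  \<comment> \<open>The ratio is invariant under scaling, so its maximum over \<open>S\<close> is
    its maximum over the whole punctured cone.\<close>
  have normalise: "\<exists>c\<in>S. r c = - b y y / f y y" if y: "y \<noteq> 0" "b y y \<le> 0" for y
  proof -
    define c where "c = representation B y"
    have c: "\<phi> c = y"
      unfolding \<phi>_def c_def using sum_representation_eq[OF B(2) _ B(1) subset_refl, of y] B(3) by simp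
    define n where "n = sqrt (\<Sum>v\<in>B. (c v)\<^sup>2)"
    define d where "d v = c v / n" for v
    have supp: "c v = 0" if "v \<notin> B" for v
      unfolding c_def using that representation_ne_zero by blast
    have "(\<Sum>v\<in>B. (c v)\<^sup>2) \<noteq> 0"
    proof
      assume "(\<Sum>v\<in>B. (c v)\<^sup>2) = 0"
      then have "\<forall>v\<in>B. c v = 0" using B(1) by (simp add: sum_nonneg_eq_0_iff)
      then have "\<phi> c = 0" unfolding \<phi>_def by simp
      then show False using c y by simp
    qed
    moreover have "(\<Sum>v\<in>B. (c v)\<^sup>2) \<ge> 0" by (simp add: sum_nonneg)
    ultimately have n: "n > 0" "n\<^sup>2 = (\<Sum>v\<in>B. (c v)\<^sup>2)" unfolding n_def by auto
    have \<phi>d: "\<phi> d = (1/n) *\<^sub>R y"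
      unfolding c[symmetric] \<phi>_def d_def by (simp add: scaleR_sum_right)
    have "(\<Sum>v\<in>B. (d v)\<^sup>2) = (\<Sum>v\<in>B. (c v)\<^sup>2) / n\<^sup>2"
      unfolding d_def by (simp only: power_divide sum_divide_distrib)
    then have one: "(\<Sum>v\<in>B. (d v)\<^sup>2) = 1"
      using n(1) by (simp flip: n(2))
    have "\<bar>d v\<bar> \<le> 1" if "v \<in> B" for v
      using member_le_sum[OF that, of "\<lambda>v. (d v)\<^sup>2"] B(1) one by (simp add: abs_square_le_1)
    then have "- 1 \<le> d v \<and> d v \<le> 1" if "v \<in> B" for v
      using that by (metis abs_le_iff minus_le_iff)
    moreover have "d v = 0" if "v \<notin> B" for v
      unfolding d_def using supp[OF that] by simp
    ultimately have "d \<in> box" unfolding box_def by auto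
    then have "d \<in> S"
      unfolding S_def using one y n by (simp add: \<phi>d b.scale divide_nonpos_pos)
    moreover have "r d = - b y y / f y y"
      unfolding r_def \<phi>d using n by (simp add: b.scale f.scale)
    ultimately show ?thesis by blast
  qed
  have u0: "u \<noteq> 0" using u by auto
  have "S \<noteq> {}" using normalise[of u] u u0 by auto
  have fS: "f (\<phi> c) (\<phi> c) > 0" if "c \<in> S" for c
    using fpos \<phi>_ne that unfolding S_def by blast
  have "continuous_on S r"
    unfolding r_def using fS
    by (intro continuous_intros continuous_on_subset[OF cont]) (auto simp: assms less_imp_neq[symmetric])
  then obtain m where m: "m \<in> S" and max: "\<And>c. c \<in> S \<Longrightarrow> r c \<le> r m"
    using continuous_attains_sup[OF \<open>compact S\<close> \<open>S \<noteq> {}\<close>] by blast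
  define x where "x = \<phi> m"
  define M where "M = r m"
  have ub: "- b y y \<le> M * f y y" if y: "b y y \<le> 0" for y
  proof (cases "y = 0")
    case False
    obtain c where "c \<in> S" "r c = - b y y / f y y" using normalise[OF False y] by blast
    then have "- b y y / f y y \<le> M" using max unfolding M_def by metis
    then show ?thesis using fpos[OF False y] by (simp add: field_simps)
  qed simp
  have fx: "f x x > 0" using fS[OF m] unfolding x_def .
  have "M > 0"
    using ub[of u] u fpos[OF u0] by (smt (verit) mult_nonneg_nonpos2 mult.commute)
  have eq: "b x x = - M * f x x"
    unfolding M_def r_def using fx by (simp add: x_def)
  then have neg: "b x x < 0" using fx \<open>M > 0\<close> by simp
  have "b x y = - M * f x y" for y
  proof -
    define P where "P t = b (x + t *\<^sub>R y) (x + t *\<^sub>R y)" for t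
    \<comment> \<open>First variation: since \<open>b x x < 0\<close>, moving from \<open>x\<close>
      along \<open>y\<close> stays in the cone for small \<open>t\<close>, so \<open>Q\<close> has a
      local maximum with value \<open>0\<close> at \<open>t = 0\<close>.\<close>
    define Q where "Q t = - P t - M * f (x + t *\<^sub>R y) (x + t *\<^sub>R y)" for t
    have Pexp: "P = (\<lambda>t. b x x + 2 * t * b x y + t\<^sup>2 * b y y)"
      unfolding P_def by (simp add: b.expand)
    have "isCont P 0" unfolding Pexp by (intro continuous_intros)
    moreover have "P 0 < 0" using neg by (simp add: P_def)
    ultimately have "\<forall>\<^sub>F t in at 0. P t < 0"
      using order_tendstoD(2) unfolding isCont_def by blast
    then obtain d where d: "d > 0" "\<And>t. t \<noteq> 0 \<Longrightarrow> dist t 0 < d \<Longrightarrow> P t < 0"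
      unfolding eventually_at by blast
    have "Q t \<le> Q 0" if "\<bar>0 - t\<bar> < d" for t
    proof -
      have "P t \<le> 0" using d(2)[of t] that \<open>P 0 < 0\<close> by (cases "t = 0") auto
      then have "Q t \<le> 0" using ub unfolding P_def Q_def by simp
      moreover have "Q 0 = 0" unfolding Q_def P_def using eq by simp
      ultimately show ?thesis by simp
    qed
    moreover have "(Q has_real_derivative - 2 * b x y - M * (2 * f x y)) (at 0)"
      unfolding Q_def Pexp f.expand by (auto intro!: derivative_eq_intros)
    ultimately have "- 2 * b x y - M * (2 * f x y) = 0"
      using DERIV_local_max d(1) by blast
    then show ?thesis by simp
  qed
  then show thesis using that \<open>M > 0\<close> neg by blast
qed


section \<open>Orthonormal bases\<close>

definition orthonormal_basis :: "('a::real_vector \<Rightarrow> 'a \<Rightarrow> real) \<Rightarrow> 'a set \<Rightarrow> bool" where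
  "orthonormal_basis b A \<longleftrightarrow> finite A \<and> (\<forall>e\<in>A. \<forall>e'\<in>A. b e e' = (if e = e' then 1 else 0)) \<and>
     (\<forall>x. x = (\<Sum>e\<in>A. b x e *\<^sub>R e))"

text \<open>An orthonormal family of largest size works: a vector that differs from its expansion
  leaves a remainder which, once normalised, enlarges the family.\<close>

lemma ex_orthonormal_basis:
  fixes b :: "'a::real_vector \<Rightarrow> 'a \<Rightarrow> real"
  assumes fd: "finite_dimensional_space TYPE('a)" and "symmetric_form b"
    and pos: "\<And>x. x \<noteq> 0 \<Longrightarrow> b x x > 0"
  obtains A where "orthonormal_basis b A"
proof -
  interpret b: symmetric_form b by fact
  obtain B :: "'a set" where B: "finite B" "independent B" "span B = UNIV"
    using finite_basis[OF fd] .
  define P where "P A \<longleftrightarrow> finite A \<and> (\<forall>e\<in>A. \<forall>e'\<in>A. b e e' = (if e = e' then 1 else 0))" for A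
  have coeff: "b (\<Sum>v\<in>A. c v *\<^sub>R v) e = c e" if "P A" "e \<in> A" for A e c
  proof -
    have "b (\<Sum>v\<in>A. c v *\<^sub>R v) e = (\<Sum>v\<in>A. if v = e then c v else 0)"
      unfolding b.sum_left using that by (intro sum.cong) (auto simp: P_def b.scale)
    then show ?thesis using that unfolding P_def by (simp add: sum.delta)
  qed
  have card: "card A \<le> card B" if "P A" for A
  proof -
    have fin: "finite A" using that unfolding P_def by blast
    have "independent A"
      unfolding dependent_finite[OF fin] using coeff[OF that] by (metis b.zero(1))
    then show ?thesis using independent_span_bound[OF B(1)] B(3) by simp
  qed
  have "P {}" unfolding P_def by simp
  then obtain A where A: "P A" and max: "\<And>A'. P A' \<Longrightarrow> card A' \<le> card A"
    using ex_has_greatest_nat[of P "{}" card "Suc (card B)"] card by (metis le_imp_less_Suc)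
  have "x = (\<Sum>e\<in>A. b x e *\<^sub>R e)" for x
  proof (rule ccontr)
    define y where "y = x - (\<Sum>e\<in>A. b x e *\<^sub>R e)"
    assume "x \<noteq> (\<Sum>e\<in>A. b x e *\<^sub>R e)"
    then have ypos: "b y y > 0" unfolding y_def by (intro pos) simp
    have orth: "b y e = 0" if "e \<in> A" for e
      unfolding y_def b.diff coeff[OF A that] by simp
    define z where "z = (1 / sqrt (b y y)) *\<^sub>R y"
    have zz: "b z z = 1" unfolding z_def using ypos by (simp add: b.scale)
    have ze: "b z e = 0" "b e z = 0" if "e \<in> A" for e
      unfolding z_def b.scale b.sym[of e] using orth[OF that] by (simp_all add: b.sym[of e])
    then have "z \<notin> A" using zz by auto
    moreover have "P (insert z A)"
      using A zz ze \<open>z \<notin> A\<close> unfolding P_def by auto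
    ultimately show False using max[of "insert z A"] A unfolding P_def by auto
  qed
  then show thesis using A that unfolding P_def orthonormal_basis_def by blast
qed

lemma orthonormal_basis_expansion: "orthonormal_basis b A \<Longrightarrow> x = (\<Sum>e\<in>A. b x e *\<^sub>R e)"
  unfolding orthonormal_basis_def by blast

text \<open>The matrix \<open>b (Z e) e'\<close> is antisymmetric, so exchanging the summation
  indices turns one sum into minus the other. Invariance of both \<open>K\<close> and
  \<open>casimir_form\<close> rests on this.\<close>

lemma sum_skew_orthonormal_eq_0:
  assumes "symmetric_form b" and A: "orthonormal_basis b A"
    and skew: "\<And>x y. b (Z x) y = - b x (Z y)" and \<beta>: "bilinear \<beta>"
  shows "(\<Sum>e\<in>A. \<beta> (Z e) e + \<beta> e (Z e)) = (0::real)"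
proof -
  interpret b: symmetric_form b by fact
  have l: "\<beta> (Z e) e = (\<Sum>e'\<in>A. b (Z e) e' * \<beta> e' e)" for e
    by (subst orthonormal_basis_expansion[OF A, of "Z e"])
      (simp add: linear_sum[of "\<lambda>x. \<beta> x e"] \<beta>[unfolded bilinear_def] bilinear_lmul[OF \<beta>])
  have r: "\<beta> e (Z e) = (\<Sum>e'\<in>A. b (Z e) e' * \<beta> e e')" for e
    by (subst orthonormal_basis_expansion[OF A, of "Z e"])
      (simp add: linear_sum[of "\<beta> e"] \<beta>[unfolded bilinear_def] bilinear_rmul[OF \<beta>])
  have "(\<Sum>e\<in>A. \<beta> (Z e) e) = (\<Sum>e\<in>A. \<Sum>e'\<in>A. b (Z e') e * \<beta> e e')"
    unfolding l by (rule sum.swap)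
  also have "\<dots> = (\<Sum>e\<in>A. \<Sum>e'\<in>A. - (b (Z e) e' * \<beta> e e'))"
    by (intro sum.cong refl) (metis skew b.sym mult_minus_left)
  also have "\<dots> = - (\<Sum>e\<in>A. \<beta> e (Z e))"
    unfolding r by (simp add: sum_negf)
  finally show ?thesis by (simp add: sum.distrib)
qed

lemma Riesz_representation:
  fixes l :: "'a::real_vector \<Rightarrow> real"
  assumes "finite_dimensional_space TYPE('a)" and "symmetric_form b"
    and "\<And>x. x \<noteq> 0 \<Longrightarrow> b x x > 0" and l: "linear l"
  obtains w where "\<And>y. b w y = l y"
proof -
  interpret b: symmetric_form b by fact
  obtain A where A: "orthonormal_basis b A" using ex_orthonormal_basis[OF assms(1-3)] .
  have "b (\<Sum>e\<in>A. l e *\<^sub>R e) y = l y" for y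
  proof -
    have "l y = (\<Sum>e\<in>A. b y e * l e)"
      by (subst orthonormal_basis_expansion[OF A, of y])
        (simp add: linear_sum[OF l] linear_scale[OF l])
    then show ?thesis by (simp add: b.sum_left b.scale b.sym[of y] mult.commute)
  qed
  then show thesis using that by blast
qed

section \<open>Lorentzian direct sums\<close>

text \<open>The maximum in \<open>form_index\<close> is attained by a negative line, and two
  orthogonal negative vectors would span a negative definite plane.\<close>

lemma lorentzian_index:
  fixes b :: "'a::real_vector \<Rightarrow> 'a \<Rightarrow> real"
  assumes fd: "finite_dimensional_space TYPE('a)" and L: "lorentzian_metric b"
  shows "\<exists>x. b x x < 0" and "\<And>x y. b x x < 0 \<Longrightarrow> b y y < 0 \<Longrightarrow> b x y \<noteq> 0"
proof -
  let ?D = "{dim S | S. subspace S \<and> (\<forall>x\<in>S. x \<noteq> 0 \<longrightarrow> b x x < 0)}"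
  interpret b: symmetric_form b
    using L symmetric_form_if_vs_metric unfolding lorentzian_metric_def by blast
  obtain B :: "'a set" where B: "finite B" "span B = UNIV" using finite_basis[OF fd] .
  have "?D \<subseteq> {..card B}" using dim_le_card[of _ B] B by auto
  then have fin: "finite ?D" using finite_subset by blast
  have max: "Max ?D = 1" using L unfolding lorentzian_metric_def form_index_def by simp
  \<comment> \<open>Nonemptiness, together with finiteness, ensures that \<open>Max\<close> is
    attained.\<close>
  have "dim {0::'a} \<in> ?D" by (rule CollectI) (intro exI[of _ "{0}"]; auto simp: subspace_single_0)
  then have "Max ?D \<in> ?D" using Max_in[OF fin] by blast
  then obtain S where S: "dim S = 1" "subspace S" "\<forall>x\<in>S. x \<noteq> 0 \<longrightarrow> b x x < 0"
    unfolding max by auto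
  have "\<not> S \<subseteq> {0}"
  proof
    assume "S \<subseteq> {0}"
    then have "dim S \<le> card ({}::'a set)" by (intro dim_le_card) auto
    then show False using S by simp
  qed
  then show "\<exists>x. b x x < 0" using S by blast
  fix x y assume x: "b x x < 0" and y: "b y y < 0"
  show "b x y \<noteq> 0"
  proof
    assume xy: "b x y = 0"
    have neg: "b z z < 0" if zspan: "z \<in> span {x, y}" and "z \<noteq> 0" for z
    proof -
      obtain s where "z - s *\<^sub>R x \<in> span {y}"
        using zspan span_breakdown_eq[of z x "{y}"] by blast
      then obtain t where "z - s *\<^sub>R x = t *\<^sub>R y" unfolding span_singleton by blast
      then have z: "z = s *\<^sub>R x + t *\<^sub>R y" by (simp add: algebra_simps)
      have zz: "b z z = s\<^sup>2 * b x x + t\<^sup>2 * b y y"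
        unfolding z using xy by (simp add: b.add b.scale b.sym[of y x] power2_eq_square)
      have "s\<^sup>2 * b x x \<le> 0" "t\<^sup>2 * b y y \<le> 0"
        using x y by (simp_all add: mult_nonneg_nonpos)
      moreover have "s\<^sup>2 * b x x \<noteq> 0 \<or> t\<^sup>2 * b y y \<noteq> 0" using that z x y by auto
      ultimately show ?thesis unfolding zz by linarith
    qed
    have ne: "x \<noteq> y" "x \<noteq> 0" "y \<noteq> 0" using x y xy by auto
    have "x \<notin> span {y}"
      using xy x y ne by (auto simp: span_singleton b.scale)
    then have ind: "independent {x, y}"
      using ne by (simp add: independent_insert dependent_single)
    have "dim (span {x, y}) = 2"
      using dim_span_eq_card_independent[OF ind] ne by simp
    then have "2 \<in> ?D"
      by (intro CollectI exI[of _ "span {x, y}"]) (simp add: neg)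
    then have "2 \<le> Max ?D" by (rule Max_ge[OF fin])
    then show False using max by simp
  qed
qed

lemma finite_dimensional_space_prod:
  assumes "finite_dimensional_space TYPE('a::real_vector)" "finite_dimensional_space TYPE('b::real_vector)"
  shows "finite_dimensional_space TYPE('a \<times> 'b)"
proof -
  obtain A :: "'a set" where A: "finite A" "span A = UNIV" using finite_basis[OF assms(1)] .
  obtain B :: "'b set" where B: "finite B" "span B = UNIV" using finite_basis[OF assms(2)] .
  let ?f = "\<lambda>x::'a. (x, 0::'b)" and ?g = "\<lambda>y::'b. (0::'a, y)"
  have f: "linear ?f" and g: "linear ?g" by (auto intro!: linearI)
  have "p \<in> span (?f ` A \<union> ?g ` B)" for p
  proof -
    have "?f (fst p) \<in> span (?f ` A)" "?g (snd p) \<in> span (?g ` B)"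
      using A B linear_span_image[OF f, of A] linear_span_image[OF g, of B] by auto
    then have "?f (fst p) + ?g (snd p) \<in> span (?f ` A \<union> ?g ` B)"
      by (meson span_add span_mono subsetD sup_ge1 sup_ge2)
    then show ?thesis by simp
  qed
  then show ?thesis
    unfolding finite_dimensional_space_def using A(1) B(1) by (intro exI[of _ "?f ` A \<union> ?g ` B"]) auto
qed

text \<open>The complement of a timelike vector is positive definite. For null \<open>x\<close>,
  shifting \<open>y\<close> along \<open>x\<close> into the complement of \<open>u\<close> leaves
  \<open>b y y\<close> unchanged and reduces to that case.\<close>

lemma orthogonal_to_causal:
  assumes v: "vs_metric b"
    and one: "\<And>x y. b x x < 0 \<Longrightarrow> b y y < 0 \<Longrightarrow> b x y \<noteq> 0" and u: "b u u < 0"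
    and x: "x \<noteq> 0" "b x x \<le> 0" and y: "b x y = 0"
  shows "b y y \<ge> 0" and "b y y = 0 \<Longrightarrow> y \<in> span {x}"
proof -
  interpret b: symmetric_form b using symmetric_form_if_vs_metric[OF v] .
  have nonneg: "b z z \<ge> 0" if "b w w < 0" "b w z = 0" for w z
    using that by (metis not_le one)
  have definite: "z = 0" if w: "b w w < 0" "b w z = 0" and z: "b z z = 0" for w z
  proof (rule vs_metric_nondegenerate[OF v])
    fix a
    \<comment> \<open>Cauchy-Schwarz in the semidefinite complement of \<open>w\<close> makes the
      isotropic \<open>z\<close> orthogonal to \<open>a'\<close>, and hence to
      \<open>a\<close>.\<close>
    define a' where "a' = a - (b w a / b w w) *\<^sub>R w"
    have wa': "b w a' = 0" unfolding a'_def using w by (simp add: b.diff b.scale)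
    have "(b z a')\<^sup>2 \<le> b z z * b a' a'"
      by (rule b.Cauchy_Schwarz) (rule nonneg[OF w(1)], simp add: b.add b.scale w wa')
    then have "b z a' = 0" using z by simp
    then show "b z a = 0" unfolding a'_def using w by (simp add: b.diff b.scale b.sym[of z w])
  qed
  have "b y y \<ge> 0 \<and> (b y y = 0 \<longrightarrow> y \<in> span {x})"
  proof (cases "b x x < 0")
    case True
    then show ?thesis using nonneg[OF True y] definite[OF True y] span_zero by auto
  next
    case False
    then have x0: "b x x = 0" using x by simp
    have ux: "b u x \<noteq> 0" using definite[OF u _ x0] x(1) by blast
    define y' where "y' = y - (b u y / b u x) *\<^sub>R x"
    have uy': "b u y' = 0" unfolding y'_def using ux by (simp add: b.diff b.scale)
    have y'y': "b y' y' = b y y"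
      unfolding y'_def using x0 y by (simp add: b.diff b.scale b.sym[of y x])
    have "y \<in> span {x}" if "y' = 0"
      using that unfolding y'_def by (auto simp: span_singleton)
    then show ?thesis using nonneg[OF u uy'] definite[OF u uy'] unfolding y'y' by blast
  qed
  then show "b y y \<ge> 0" "b y y = 0 \<Longrightarrow> y \<in> span {x}" by blast+
qed

section \<open>Data sets\<close>

locale lorentzian_sum_data_set =
  fixes br :: "'g::real_vector \<Rightarrow> 'g \<Rightarrow> 'g"
    and bg :: "'g \<Rightarrow> 'g \<Rightarrow> real"
    and bv :: "'v::real_vector \<Rightarrow> 'v \<Rightarrow> real"
    and \<pi> :: "'g \<Rightarrow> 'v \<Rightarrow> 'v"
  assumes data: "data_set br bg bv \<pi>"
    and lorentz: "lorentzian_metric (direct_sum_metric bg bv)"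
begin

lemma fd: "finite_dimensional_space TYPE('g)" "finite_dimensional_space TYPE('v)"
  using data unfolding data_set_def by blast+

lemma metric: "vs_metric bg" "vs_metric bv"
  using data unfolding data_set_def by blast+

sublocale bg: symmetric_form bg using symmetric_form_if_vs_metric[OF metric(1)] .
sublocale bv: symmetric_form bv using symmetric_form_if_vs_metric[OF metric(2)] .

lemma ad_skew: "bg (br Z X) Y = - bg X (br Z Y)"
  using data unfolding data_set_def so_endos_def by blast

lemma br_bilinear: "bilinear br" and br_self: "br X X = 0"
  using data unfolding data_set_def lie_bracket_def by blast+

lemma br_antisym: "br X Y = - br Y X"
proof -
  have "br X Y + br Y X = br (X + Y) (X + Y)"
    by (simp only: bilinear_ladd[OF br_bilinear] bilinear_radd[OF br_bilinear] br_self[of X] br_self[of Y]) simp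
  then show ?thesis by (simp add: br_self eq_neg_iff_add_eq_0)
qed

lemma representation: "faithful_so_representation br bv \<pi>"
  using data unfolding data_set_def by blast

lemma \<pi>_skew: "bv (\<pi> Z x) y = - bv x (\<pi> Z y)"
  using representation unfolding faithful_so_representation_def so_endos_def by blast

lemma \<pi>_linear: "linear (\<pi> Z)"
  using representation unfolding faithful_so_representation_def so_endos_def by blast

lemma \<pi>_linear_left: "linear (\<lambda>Z. \<pi> Z x)"
  using representation unfolding faithful_so_representation_def by blast

lemma \<pi>_br: "\<pi> (br Z W) x = \<pi> Z (\<pi> W x) - \<pi> W (\<pi> Z x)"
  using representation unfolding faithful_so_representation_def by blast

lemma \<pi>_faithful: "(\<And>x. \<pi> Z x = 0) \<Longrightarrow> Z = 0"
proof -
  assume "\<And>x. \<pi> Z x = 0"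
  then have "\<pi> Z = \<pi> 0" using linear_0[OF \<pi>_linear_left] by auto
  then show ?thesis
    using representation unfolding faithful_so_representation_def by (auto dest: injD)
qed

lemma bilinear_\<pi>: "bilinear (\<lambda>X Y. bv (\<pi> X x) (\<pi> Y y))"
  unfolding bilinear_def
  using linear_compose[OF \<pi>_linear_left bv.linear_right] linear_compose[OF \<pi>_linear_left bv.linear_left]
  by (auto simp: o_def)

lemma \<pi>_sum_eq: "orthonormal_basis bg A \<Longrightarrow> \<pi> X x = (\<Sum>e\<in>A. bg X e *\<^sub>R \<pi> e x)"
  by (subst orthonormal_basis_expansion[of bg A X])
    (simp_all add: linear_sum[OF \<pi>_linear_left] linear_scale[OF \<pi>_linear_left])

lemma \<pi>_orthogonal: "bv x (\<pi> Z x) = 0"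
  using \<pi>_skew[of Z x x] bv.sym[of x "\<pi> Z x"] by simp

lemma negative_somewhere: "(\<exists>Z. bg Z Z < 0) \<or> (\<exists>x. bv x x < 0)"
proof -
  obtain p where "direct_sum_metric bg bv p p < 0"
    using lorentzian_index(1)[OF finite_dimensional_space_prod[OF fd] lorentz] by blast
  then have "bg (fst p) (fst p) < 0 \<or> bv (snd p) (snd p) < 0"
    unfolding direct_sum_metric_def by linarith
  then show ?thesis by blast
qed

text \<open>The index bound is pulled back along \<open>(X, 0)\<close> and \<open>(0, y)\<close>.
  Such vectors are orthogonal to each other, so at most one of \<open>bg\<close> and
  \<open>bv\<close> takes negative values.\<close>

lemma no_two_negative:
  shows "bg X X < 0 \<Longrightarrow> bg Y Y < 0 \<Longrightarrow> bg X Y \<noteq> 0"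
    and "bv x x < 0 \<Longrightarrow> bv y y < 0 \<Longrightarrow> bv x y \<noteq> 0"
    and "bg X X < 0 \<Longrightarrow> bv y y \<ge> 0"
  using lorentzian_index(2)[OF finite_dimensional_space_prod[OF fd] lorentz, of "(X, 0)" "(Y, 0)"]
    lorentzian_index(2)[OF finite_dimensional_space_prod[OF fd] lorentz, of "(0, x)" "(0, y)"]
    lorentzian_index(2)[OF finite_dimensional_space_prod[OF fd] lorentz, of "(X, 0)" "(0, y)"]
  unfolding direct_sum_metric_def by (auto simp: not_less[symmetric])

section \<open>Negative vectors in the Lie algebra\<close>

lemma center_nonzero_if_negative:
  assumes "bg Z0 Z0 < 0"
  shows "lie_center br \<noteq> {0}"
proof -
  have vpos: "bv x x > 0" if "x \<noteq> 0" for x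
    using bv.definite_if_semidefinite[OF no_two_negative(3)[OF assms] vs_metric_nondegenerate[OF metric(2)] that] .
  obtain A where A: "orthonormal_basis bv A"
    using ex_orthonormal_basis[OF fd(2) bv.symmetric_form_axioms vpos] .
  have finA: "finite A" using A unfolding orthonormal_basis_def by blast
  define K where "K X Y = (\<Sum>e\<in>A. bv (\<pi> X e) (\<pi> Y e))" for X Y
  have "bilinear K"
    unfolding K_def bilinear_def
    using bilinear_\<pi> unfolding bilinear_def by (auto intro!: linear_compose_sum)
  then interpret K: symmetric_form K
    by unfold_locales (auto simp: K_def bv.sym)
  have Kpos: "K X X > 0" if "X \<noteq> 0" for X
  proof -
    have nonneg: "bv x x \<ge> 0" for x using vpos[of x] by (cases "x = 0") auto
    have "K X X \<noteq> 0"
    proof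
      assume "K X X = 0"
      then have "\<forall>e\<in>A. \<pi> X e = 0"
        unfolding K_def using finA nonneg vpos by (subst (asm) sum_nonneg_eq_0_iff) force+
      then have "\<pi> X x = 0" for x
        by (subst orthonormal_basis_expansion[OF A, of x])
          (simp add: linear_sum[OF \<pi>_linear] linear_scale[OF \<pi>_linear])
      then show False using \<pi>_faithful that by blast
    qed
    moreover have "K X X \<ge> 0" unfolding K_def by (intro sum_nonneg nonneg)
    ultimately show ?thesis by simp
  qed
  have K_skew: "K (br Z X) Y = - K X (br Z Y)" for X Y Z
  proof -
    have bil: "bilinear (\<lambda>x y. bv (\<pi> X x) (\<pi> Y y))"
      unfolding bilinear_def
      using linear_compose[OF \<pi>_linear bv.linear_right] linear_compose[OF \<pi>_linear bv.linear_left]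
      by (auto simp: o_def)
    \<comment> \<open>The terms with \<open>\<pi> Z\<close> outermost cancel by skewness; what
      remains is a skew contraction over \<open>A\<close>.\<close>
    have "K (br Z X) Y + K X (br Z Y)
        = - (\<Sum>e\<in>A. bv (\<pi> X (\<pi> Z e)) (\<pi> Y e) + bv (\<pi> X e) (\<pi> Y (\<pi> Z e)))"
      unfolding K_def \<pi>_br bv.diff sum.distrib[symmetric] sum_negf[symmetric]
      by (intro sum.cong refl) (simp add: \<pi>_skew[of Z])
    also have "\<dots> = 0"
      using sum_skew_orthonormal_eq_0[of bv A "\<pi> Z", OF bv.symmetric_form_axioms A \<pi>_skew bil] by simp
    finally show ?thesis by simp
  qed
  obtain T M where M: "M > 0" and T: "bg T T < 0" and eig: "\<And>Y. bg T Y = - M * K T Y"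
    using pencil_eigenvector[OF fd(1) bg.symmetric_form_axioms K.symmetric_form_axioms assms Kpos] by blast
  have "br Z T = 0" for Z
  proof (rule ccontr)
    assume ne: "br Z T \<noteq> 0"
    \<comment> \<open>Both forms are invariant, so \<open>br Z T\<close> inherits the eigenvector
      relation of \<open>T\<close> and would be a second negative direction, orthogonal to
      \<open>T\<close>.\<close>
    have "bg (br Z T) (br Z T) = - M * K (br Z T) (br Z T)"
      by (simp add: ad_skew[of Z T] eig K_skew[of Z T])
    then have "bg (br Z T) (br Z T) < 0" using M Kpos[OF ne] by simp
    moreover have "bg T (br Z T) = 0" using ad_skew[of Z T T] bg.sym[of T "br Z T"] by simp
    ultimately show False using no_two_negative(1)[OF T] by blast
  qed
  then have "T \<in> lie_center br" unfolding lie_center_def using br_antisym[of T] by simp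
  moreover have "T \<noteq> 0" using T by auto
  ultimately show ?thesis by blast
qed

end

section \<open>Trivial center and definite Lie algebra metric\<close>

locale centerless_data_set = lorentzian_sum_data_set +
  assumes center: "lie_center br = {0}"
begin

lemma bg_pos: "X \<noteq> 0 \<Longrightarrow> bg X X > 0"
  using bg.definite_if_semidefinite[OF _ vs_metric_nondegenerate[OF metric(1)]]
    center_nonzero_if_negative center by (metis not_le)

lemma timelike_exists: "\<exists>u. bv u u < 0"
  using negative_somewhere center_nonzero_if_negative center by blast

lemma causal_orthogonal:
  assumes "x \<noteq> 0" "bv x x \<le> 0" "bv x y = 0"
  shows "bv y y \<ge> 0" and "bv y y = 0 \<Longrightarrow> y \<in> span {x}"
  using orthogonal_to_causal[OF metric(2) no_two_negative(2) _ assms] timelike_exists by blast+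

text \<open>Perfectness: if \<open>bg T\<close> vanishes on all brackets, then \<open>T\<close> is central by invariance.\<close>

lemma fixed_if_derived_fixed:
  assumes "\<And>X Y. \<pi> (br X Y) x = 0"
  shows "x \<in> common_kernel \<pi>"
proof -
  have "bv (\<pi> X x) y = 0" for X y
  proof -
    obtain T where T: "\<And>X. bg T X = bv (\<pi> X x) y"
      using Riesz_representation[OF fd(1) bg.symmetric_form_axioms bg_pos
          linear_compose[OF \<pi>_linear_left bv.linear_left]] by (metis comp_apply)
    have "br Z T = 0" for Z
    proof (rule vs_metric_nondegenerate[OF metric(1)])
      show "bg (br Z T) W = 0" for W
        unfolding ad_skew T assms by simp
    qed
    then have "T \<in> lie_center br" unfolding lie_center_def using br_antisym[of T] by simp
    then have "T = 0" using center by simp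
    then show ?thesis using T[of X] by simp
  qed
  then show ?thesis
    unfolding common_kernel_def using vs_metric_nondegenerate[OF metric(2)] by blast
qed

text \<open>The representation acts on the line of \<open>y\<close> by scalars, which commute, or
  kills it. Either way brackets annihilate \<open>x\<close>, and perfectness applies.\<close>

lemma fixed_if_fixed_line:
  assumes x: "\<And>X. \<pi> X x \<in> span {y}" and y: "y \<in> span {x} \<or> y \<in> common_kernel \<pi>"
  shows "x \<in> common_kernel \<pi>"
proof (rule fixed_if_derived_fixed)
  fix X Y
  have "\<forall>X. \<exists>k. \<pi> X x = k *\<^sub>R y" using x unfolding span_singleton by blast
  then obtain c where c: "\<And>X. \<pi> X x = c X *\<^sub>R y" by metis
  have "c Z *\<^sub>R \<pi> W y = c W *\<^sub>R \<pi> Z y" for Z W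
    using y
  proof
    assume "y \<in> span {x}"
    then obtain k where "y = k *\<^sub>R x" unfolding span_singleton by blast
    then have "\<pi> W y = (k * c W) *\<^sub>R y" for W by (metis c linear_scale[OF \<pi>_linear] scaleR_scaleR)
    then show ?thesis by simp
  qed (simp add: common_kernel_def)
  moreover have "\<pi> (br X Y) x = c Y *\<^sub>R \<pi> X y - c X *\<^sub>R \<pi> Y y"
    by (simp only: \<pi>_br[of X Y x] c[of X] c[of Y] linear_scale[OF \<pi>_linear])
  ultimately show "\<pi> (br X Y) x = 0" by (metis diff_self)
qed

section \<open>The Casimir form\<close>

definition g_basis where "g_basis = (SOME A. orthonormal_basis bg A)"

lemma g_basis: "orthonormal_basis bg g_basis"
  unfolding g_basis_def
  using ex_orthonormal_basis[OF fd(1) bg.symmetric_form_axioms bg_pos] by (metis someI_ex)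

lemma finite_g_basis: "finite g_basis"
  using g_basis unfolding orthonormal_basis_def by blast

text \<open>The form \<open>f x y = - bv (C x) y\<close> for the Casimir operator \<open>C\<close> of \<open>bg\<close>.\<close>

definition casimir_form where "casimir_form x y = (\<Sum>e\<in>g_basis. bv (\<pi> e x) (\<pi> e y))"

sublocale casimir: symmetric_form casimir_form
proof
  have "bilinear (\<lambda>x y. bv (\<pi> e x) (\<pi> e y))" for e
    unfolding bilinear_def
    using linear_compose[OF \<pi>_linear bv.linear_right] linear_compose[OF \<pi>_linear bv.linear_left]
    by (auto simp: o_def)
  then show "bilinear casimir_form"
    unfolding casimir_form_def bilinear_def by (auto intro!: linear_compose_sum)
qed (simp add: casimir_form_def bv.sym)

text \<open>Inserting terms that cancel by skewness of \<open>\<pi> Z\<close> produces the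
  commutators \<open>\<pi> (br Z e)\<close>; their contraction vanishes because \<open>br Z\<close>
  is skew for \<open>bg\<close>.\<close>

lemma casimir_invariant: "casimir_form (\<pi> Z x) y = - casimir_form x (\<pi> Z y)"
proof -
  have "casimir_form (\<pi> Z x) y + casimir_form x (\<pi> Z y)
      = - (\<Sum>e\<in>g_basis. bv (\<pi> (br Z e) x) (\<pi> e y) + bv (\<pi> e x) (\<pi> (br Z e) y))"
    unfolding casimir_form_def sum.distrib[symmetric] sum_negf[symmetric] \<pi>_br bv.diff
    by (intro sum.cong refl) (simp add: \<pi>_skew[of Z])
  also have "\<dots> = 0"
    using sum_skew_orthonormal_eq_0[of bg g_basis "br Z", OF bg.symmetric_form_axioms g_basis ad_skew bilinear_\<pi>]
    by simp
  finally show ?thesis by simp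
qed

text \<open>Every \<open>\<pi> X x\<close> lies in the complement of a causal vector, where
  \<open>bv\<close> is semidefinite and isotropic vectors are multiples of \<open>E\<close>, so the
  form is a sum of nonnegative terms. It is applied with \<open>x\<close> itself as
  \<open>E\<close>, and with a null vector spanning the common kernel.\<close>

lemma casimir_form_semidefinite:
  assumes E: "E \<noteq> 0" "bv E E \<le> 0" and orth: "\<And>X. bv E (\<pi> X x) = 0"
  shows "casimir_form x x \<ge> 0" and "casimir_form x x = 0 \<Longrightarrow> \<pi> X x \<in> span {E}"
proof -
  have nonneg: "bv (\<pi> e x) (\<pi> e x) \<ge> 0" for e using causal_orthogonal(1)[OF E orth] .
  then show "casimir_form x x \<ge> 0" unfolding casimir_form_def by (simp add: sum_nonneg)
  assume "casimir_form x x = 0"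
  then have "\<forall>e\<in>g_basis. bv (\<pi> e x) (\<pi> e x) = 0"
    unfolding casimir_form_def using finite_g_basis nonneg by (simp add: sum_nonneg_eq_0_iff)
  then have "\<forall>e\<in>g_basis. \<pi> e x \<in> span {E}" using causal_orthogonal(2)[OF E orth] by blast
  then show "\<pi> X x \<in> span {E}"
    unfolding \<pi>_sum_eq[OF g_basis, of X] by (auto intro!: span_sum span_scale)
qed

lemma common_kernel_nontrivial: "common_kernel \<pi> \<noteq> {0}"
proof
  assume ker: "common_kernel \<pi> = {0}"
  have fpos: "casimir_form x x > 0" if x: "x \<noteq> 0" "bv x x \<le> 0" for x
  proof (rule ccontr)
    assume "\<not> casimir_form x x > 0"
    then have "casimir_form x x = 0" using casimir_form_semidefinite(1)[OF x \<pi>_orthogonal] by force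
    then have "\<pi> X x \<in> span {x}" for X using casimir_form_semidefinite(2)[OF x \<pi>_orthogonal] by blast
    then have "x \<in> common_kernel \<pi>" using fixed_if_fixed_line[of x x] by (simp add: span_base)
    then show False using ker x by simp
  qed
  obtain u where "bv u u < 0" using timelike_exists by blast
  then obtain x M where M: "M > 0" and x: "bv x x < 0" and eig: "\<And>y. bv x y = - M * casimir_form x y"
    using pencil_eigenvector[OF fd(2) bv.symmetric_form_axioms casimir.symmetric_form_axioms _ fpos] by metis
  have x0: "x \<noteq> 0" using x by auto
  have spacelike: "bv y y \<ge> 0" "bv y y = 0 \<Longrightarrow> y = 0" if y: "bv x y = 0" for y
  proof -
    show "bv y y \<ge> 0" using causal_orthogonal(1)[OF x0 _ y] x by simp
    assume "bv y y = 0"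
    then obtain c where "y = c *\<^sub>R x"
      using causal_orthogonal(2)[OF x0 _ y] x unfolding span_singleton by auto
    then show "y = 0" using y x by (simp add: bv.scale)
  qed
  have key: "\<pi> e (\<pi> X x) = (bv (\<pi> e (\<pi> X x)) x / bv x x) *\<^sub>R x" if e: "e \<in> g_basis" for e X
  proof -
    define y where "y = \<pi> X x"
    have xy: "bv x y = 0" unfolding y_def by (rule \<pi>_orthogonal)
    \<comment> \<open>The part of \<open>\<pi> e y\<close> orthogonal to the timelike
      \<open>x\<close>; the aim is to show that it vanishes.\<close>
    define w where "w e = \<pi> e y - (bv (\<pi> e y) x / bv x x) *\<^sub>R x" for e
    have wx: "bv x (w e) = 0" for e
      unfolding w_def using x by (simp add: bv.diff bv.scale bv.sym[of x "\<pi> e y"])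
    have wnonneg: "bv (w e) (w e) \<ge> 0" for e using spacelike(1)[OF wx] .
    \<comment> \<open>Skewness expresses the component along \<open>x\<close> through
      \<open>bv y (\<pi> e x)\<close>, the quantity that \<open>cs\<close> bounds.\<close>
    have dec: "bv (\<pi> e y) (\<pi> e y) = bv (w e) (w e) + (bv y (\<pi> e x))\<^sup>2 / bv x x" for e
    proof -
      have "\<pi> e y = w e + (bv (\<pi> e y) x / bv x x) *\<^sub>R x" unfolding w_def by simp
      then have "bv (\<pi> e y) (\<pi> e y) = bv (w e) (w e) + (bv (\<pi> e y) x / bv x x)\<^sup>2 * bv x x"
        using bv.expand[of "w e" "bv (\<pi> e y) x / bv x x" x] wx[of e] bv.sym[of "w e" x] by simp
      also have "bv (\<pi> e y) x = - bv y (\<pi> e x)" by (rule \<pi>_skew)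
      finally show ?thesis using x by (simp add: power2_eq_square)
    qed
    have cs: "(bv y (\<pi> e x))\<^sup>2 \<le> bv y y * bv (\<pi> e x) (\<pi> e x)" for e
      by (rule bv.Cauchy_Schwarz) (rule spacelike(1), simp add: bv.add bv.scale xy \<pi>_orthogonal)
    \<comment> \<open>Invariance passes the eigenvector relation from \<open>x\<close> to
      \<open>y\<close>; eliminating \<open>M\<close> between the two relations gives the comparison
      of sums below.\<close>
    have "bv y z = - M * casimir_form y z" for z
      unfolding y_def casimir_invariant \<pi>_skew[of X x] using eig[of "\<pi> X z"] by simp
    then have "casimir_form y y * bv x x = bv y y * casimir_form x x"
      using eig[of x] by simp
    \<comment> \<open>The terms on the left are nonpositive because \<open>bv x x < 0\<close>, those
      on the right nonnegative by \<open>cs\<close>; hence every \<open>bv (w e) (w e)\<close> is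
      zero.\<close>
    then have "(\<Sum>e\<in>g_basis. bv (w e) (w e) * bv x x) =
        (\<Sum>e\<in>g_basis. bv y y * bv (\<pi> e x) (\<pi> e x) - (bv y (\<pi> e x))\<^sup>2)"
      unfolding casimir_form_def dec using x
      by (simp add: sum_subtractf sum.distrib sum_distrib_left sum_distrib_right distrib_right)
    moreover have "\<dots> \<ge> 0" using cs by (intro sum_nonneg) simp
    ultimately have "(\<Sum>e\<in>g_basis. bv (w e) (w e) * (- bv x x)) \<le> 0"
      by (simp add: sum_negf)
    moreover have "bv (w e) (w e) * (- bv x x) \<le> (\<Sum>e\<in>g_basis. bv (w e) (w e) * (- bv x x))"
      by (rule member_le_sum[OF e _ finite_g_basis]) (use wnonneg x in \<open>simp add: mult_nonneg_nonpos\<close>)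
    ultimately have "bv (w e) (w e) * (- bv x x) \<le> 0" by linarith
    then have "bv (w e) (w e) = 0" using wnonneg[of e] x by (simp add: zero_le_mult_iff)
    then have "w e = 0" using spacelike(2)[OF wx] by blast
    then show ?thesis unfolding w_def y_def by simp
  qed
  have "\<pi> Z (\<pi> X x) = (bv (\<pi> Z (\<pi> X x)) x / bv x x) *\<^sub>R x" for Z X
  proof -
    have "\<pi> Z (\<pi> X x) \<in> span {x}"
      unfolding \<pi>_sum_eq[OF g_basis, of Z]
      by (intro span_sum span_scale) (metis key span_base span_scale singletonI)
    then obtain k where "\<pi> Z (\<pi> X x) = k *\<^sub>R x" unfolding span_singleton by blast
    then show ?thesis using x by (simp add: bv.scale)
  qed
  \<comment> \<open>Both sides equal \<open>- bv (\<pi> X x) (\<pi> Z x)\<close>.\<close>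
  moreover have "bv (\<pi> Z (\<pi> X x)) x = bv (\<pi> X (\<pi> Z x)) x" for Z X
    unfolding \<pi>_skew[of Z "\<pi> X x"] \<pi>_skew[of X "\<pi> Z x"] by (simp add: bv.sym)
  ultimately have "\<pi> Z (\<pi> X x) = \<pi> X (\<pi> Z x)" for Z X by metis
  then have "x \<in> common_kernel \<pi>" by (intro fixed_if_derived_fixed) (simp add: \<pi>_br)
  then show False using ker x0 by simp
qed

lemma common_kernel_not_null_line:
  assumes E: "E \<noteq> 0" "bv E E = 0"
  shows "common_kernel \<pi> \<noteq> span {E}"
proof
  assume ker: "common_kernel \<pi> = span {E}"
  then have "E \<in> common_kernel \<pi>" by (simp add: span_base)
  then have \<pi>E: "\<pi> X E = 0" for X unfolding common_kernel_def by blast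
  have orth: "bv E (\<pi> X x) = 0" for X x using \<pi>_skew[of X E x] \<pi>E by simp
  have E': "bv E E \<le> 0" using E by simp
  have line: "x \<in> span {E}" if "\<And>X. \<pi> X x \<in> span {E}" for x
    using fixed_if_fixed_line[OF that] \<pi>E \<open>E \<in> common_kernel \<pi>\<close> ker by (simp add: span_zero)
  have radical: "x \<in> span {E}" if "casimir_form x x = 0" for x
    using line casimir_form_semidefinite(2)[OF E(1) E' orth that] by blast
  have fE: "casimir_form x E = 0" for x unfolding casimir_form_def \<pi>E by simp
  obtain u where u: "bv u E \<noteq> 0"
    using vs_metric_nondegenerate[OF metric(2), of E] E(1) bv.sym by metis
  \<comment> \<open>Rank-one correction that makes \<^const>\<open>casimir_form\<close> definite, so that it represents functionals.\<close>
  define f where "f x y = casimir_form x y + bv u x * bv u y" for x y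
  interpret f: symmetric_form f
  proof
    show "bilinear f"
      unfolding bilinear_def f_def
      by (auto intro!: linearI simp: casimir.add casimir.scale bv.add bv.scale algebra_simps)
  qed (simp add: f_def casimir.sym mult.commute)
  have fpos: "f x x > 0" if "x \<noteq> 0" for x
  proof (rule ccontr)
    assume "\<not> f x x > 0"
    then have "casimir_form x x + (bv u x)\<^sup>2 \<le> 0" unfolding f_def by (simp add: power2_eq_square)
    then have "casimir_form x x = 0" "bv u x = 0"
      using casimir_form_semidefinite(1)[OF E(1) E' orth, of x] zero_le_power2[of "bv u x"]
      by (linarith, smt (verit) zero_less_power2)
    then obtain c where "x = c *\<^sub>R E" using radical unfolding span_singleton by blast
    then show False using \<open>bv u x = 0\<close> u \<open>x \<noteq> 0\<close> by (simp add: bv.scale)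
  qed
  obtain w where w: "\<And>y. f w y = bv E y"
    using Riesz_representation[OF fd(2) f.symmetric_form_axioms fpos bv.linear_right] by blast
  \<comment> \<open>At \<open>E\<close> the Casimir part of \<open>f w\<close> vanishes and
    \<open>bv E E = 0\<close>, so the correction term drops out of \<open>f w\<close>
    altogether.\<close>
  have "bv u w = 0" using w[of E] E u fE unfolding f_def by simp
  then have w: "casimir_form w y = bv E y" for y using w unfolding f_def by simp
  \<comment> \<open>By invariance, \<open>casimir_form (\<pi> Z w) (\<pi> Z w)\<close> is
    \<open>- bv E (\<pi> Z (\<pi> Z w))\<close>, and \<open>E\<close> is orthogonal to all
    images.\<close>
  have "\<pi> Z w \<in> span {E}" for Z
    by (rule radical) (simp add: casimir_invariant[of Z w] w orth)
  then have "w \<in> span {E}" by (rule line)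
  then obtain c where "w = c *\<^sub>R E" unfolding span_singleton by blast
  then have "bv E y = 0" for y
    unfolding w[symmetric] using fE casimir.sym[of E y] by (simp add: casimir.scale)
  then show False using vs_metric_nondegenerate[OF metric(2)] E(1) by blast
qed

end

text \<open>The center is an abelian ideal, hence solvable after one derived step.\<close>

lemma not_semisimple_if_center_nonzero:
  assumes "lie_bracket br" and center: "lie_center br \<noteq> {0}"
  shows "\<not> lie_semisimple br"
proof -
  have bil: "bilinear br" and self: "br x x = 0" for x
    using assms(1) unfolding lie_bracket_def by blast+
  have anti: "br y x = 0" if "br x y = 0" for x y
  proof -
    have "br y x = br (x + y) (x + y)"
      by (simp only: bilinear_ladd[OF bil] bilinear_radd[OF bil] self[of x] self[of y] that) simp
    then show ?thesis by (simp add: self)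
  qed
  have "subspace (lie_center br)"
    unfolding subspace_def lie_center_def
    by (simp add: bilinear_ladd[OF bil] bilinear_lmul[OF bil] bilinear_lzero[OF bil])
  moreover have "br x y \<in> lie_center br" if "y \<in> lie_center br" for x y
    using that anti bilinear_lzero[OF bil] unfolding lie_center_def by simp
  ultimately have "lie_ideal br (lie_center br)" unfolding lie_ideal_def by blast
  moreover have "derived_series br (lie_center br) 1 = {0}"
  proof -
    have "{br x y | x y. x \<in> lie_center br \<and> y \<in> lie_center br} \<subseteq> {0}"
      unfolding lie_center_def by auto
    then have "span {br x y | x y. x \<in> lie_center br \<and> y \<in> lie_center br} \<subseteq> span {0}"
      by (rule span_mono)
    then show ?thesis using span_zero by auto
  qed
  ultimately show ?thesis using center unfolding lie_semisimple_def by blast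
qed

theorem corollary6p5:
  fixes br :: "'g::real_vector \<Rightarrow> 'g \<Rightarrow> 'g"
    and bg :: "'g \<Rightarrow> 'g \<Rightarrow> real"
    and bv :: "'v::real_vector \<Rightarrow> 'v \<Rightarrow> real"
    and \<pi> :: "'g \<Rightarrow> 'v \<Rightarrow> 'v"
  assumes "lorentzian_data_set br bg bv \<pi> \<or> degenerate_lorentzian_data_set br bg bv \<pi>"
  shows "\<not> lie_semisimple br \<and> lie_center br \<noteq> {0}"
proof -
  have sum: "lorentzian_sum_data_set br bg bv \<pi>"
    using assms unfolding lorentzian_data_set_def degenerate_lorentzian_data_set_def
      lorentzian_sum_data_set_def by blast
  have "lie_center br \<noteq> {0}"
  proof
    assume "lie_center br = {0}"
    with sum interpret centerless_data_set br bg bv \<pi>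
      by (simp add: centerless_data_set_def centerless_data_set_axioms_def)
    show False
      using assms common_kernel_nontrivial common_kernel_not_null_line
      unfolding lorentzian_data_set_def degenerate_lorentzian_data_set_def by blast
  qed
  moreover have "lie_bracket br"
    using lorentzian_sum_data_set.data[OF sum] unfolding data_set_def by blast
  ultimately show ?thesis using not_semisimple_if_center_nonzero by blast
qed

end
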